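(* Let $\Sigma$ be a finite alphabet, let $\varepsilon,\delta\in(0,1]$, let $d>0$ be real, and let $c$ be an integer with $c>d/\delta$. Put $$\beta=\delta-\frac dc>0,\qquad \alpha_{\mathrm{hit}}=1+\frac{2d}{\beta}\bigl(\log|\Sigma|+\log 3\bigr).$$ Then there is $n_0$, depending only on $|\Sigma|,\varepsilon,\delta,d,c$, such that the following holds for every $n\ge n_0$. Let $\Pi\subseteq\Sigma^n$ and let $T$ be a one-sided nonadaptive $\varepsilon/2$-tester for $\Pi$ which has average query complexity $d$ and rejects every input $x\in\Sigma^n$ that is $\varepsilon/2$-far from $\Pi$ with probability at least $\delta$. Then $p=\alpha_{\mathrm{hit}}n^{-1/c}\le 1$ and $\Pi$ has a one-sided $p$-sampling $\varepsilon$-tester (which samples every coordinate independently with probability $p$): it rejects every $x\in\Pi$ with probability $0$ and rejects every $x\in\Sigma^n$ that is $\varepsilon$-far from $\Pi$ with probability at least $2/3$. Its expected sample complexity is $\alpha_{\mathrm{hit}}n^{1-1/c}$.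
   Context: $\log$ is the natural logarithm. For $x,y\in\Sigma^n$, $\operatorname{dist}(x,y)=\frac1n|\{i\in[n]:x_i\ne y_i\}|$, and $\operatorname{dist}(x,\Pi)=\min_{y\in\Pi}\operatorname{dist}(x,y)$. The word $x$ is $\varepsilon$-far from $\Pi$ if $\operatorname{dist}(x,\Pi)>\varepsilon$. A deterministic local test is a pair $t=(Q_t,\varphi_t)$ with $Q_t\subseteq[n]$ and $\varphi_t:\Sigma^{Q_t}\to\{0,1\}$, where $\varphi_t=1$ means rejection. A nonadaptive tester $T$ is given by a probability distribution $\mu$ on a finite set (index set) $\mathcal T$ of local tests: it samples $t\sim\mu$, queries the coordinates in $Q_t$, and outputs $\varphi_t(x|_{Q_t})$. Its rejection probability on $x$ is $r_T(x)=\mu(\{t\in\mathcal T:\varphi_t(x|_{Q_t})=1\})$, and its average query complexity is $\mathbb E_{t\sim\mu}|Q_t|$. The tester is one-sided for $\Pi$ if $r_T(x)=0$ for every $x\in\Pi$. For $p\in[0,1]$, a $p$-sampling tester receives $(W,x|_W)$, where $W\subseteq[n]$ is the random set containing each coordinate independently with probability $p$, and applies arbitrary post-processing (no running-time bound) to decide whether to accept or reject. Its expected sample complexity is $\mathbb E|W|=pn$. *)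

theory Defs
  imports "HOL-Probability.Probability"
begin

definition words :: "nat \<Rightarrow> 'a set \<Rightarrow> (nat \<Rightarrow> 'a) set" where
  "words n S = {1..n} \<rightarrow>\<^sub>E S"

definition word_dist :: "nat \<Rightarrow> (nat \<Rightarrow> 'a) \<Rightarrow> (nat \<Rightarrow> 'a) \<Rightarrow> real" where
  "word_dist n x y = real (card {i \<in> {1..n}. x i \<noteq> y i}) / real n"

text \<open>The minimum over an empty property is taken to be infinite, so every word is far from
  the empty property.\<close>

definition dist_to :: "nat \<Rightarrow> (nat \<Rightarrow> 'a) \<Rightarrow> (nat \<Rightarrow> 'a) set \<Rightarrow> ereal" where
  "dist_to n x P = (if P = {} then \<infinity> else ereal (MIN y\<in>P. word_dist n x y))"

definition far :: "nat \<Rightarrow> real \<Rightarrow> (nat \<Rightarrow> 'a) \<Rightarrow> (nat \<Rightarrow> 'a) set \<Rightarrow> bool" where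
  "far n e x P \<longleftrightarrow> dist_to n x P > ereal e"

text \<open>The local tests are given as a family indexed by \<open>tests T\<close>. The predicate
  \<open>rejects T t\<close> plays the role of the decision function of the test \<open>t\<close> (\<open>True\<close> means
  rejection); it is only ever applied to words restricted to \<open>queries T t\<close>.\<close>

record ('a, 'i) tester =
  tests :: "'i set"
  distribution :: "'i pmf"
  queries :: "'i \<Rightarrow> nat set"
  rejects :: "'i \<Rightarrow> (nat \<Rightarrow> 'a) \<Rightarrow> bool"

definition nonadaptive_tester :: "nat \<Rightarrow> ('a, 'i) tester \<Rightarrow> bool" where
  "nonadaptive_tester n T \<longleftrightarrow>
     finite (tests T) \<and> set_pmf (distribution T) \<subseteq> tests T \<and>
     (\<forall>t\<in>tests T. queries T t \<subseteq> {1..n})"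

definition reject_prob :: "('a, 'i) tester \<Rightarrow> (nat \<Rightarrow> 'a) \<Rightarrow> real" where
  "reject_prob T x =
     measure_pmf.prob (distribution T) {t \<in> tests T. rejects T t (restrict x (queries T t))}"

definition avg_queries :: "('a, 'i) tester \<Rightarrow> real" where
  "avg_queries T = measure_pmf.expectation (distribution T) (\<lambda>t. real (card (queries T t)))"

definition one_sided :: "('a, 'i) tester \<Rightarrow> (nat \<Rightarrow> 'a) set \<Rightarrow> bool" where
  "one_sided T P \<longleftrightarrow> (\<forall>x\<in>P. reject_prob T x = 0)"

definition random_subset :: "nat \<Rightarrow> real \<Rightarrow> nat set pmf" where
  "random_subset n p =
     map_pmf (\<lambda>b. {i \<in> {1..n}. b i}) (Pi_pmf {1..n} False (\<lambda>_. bernoulli_pmf p))"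

text \<open>The post-processing of a sampling tester is an arbitrary function \<open>D\<close>; \<open>D W (restrict x W)\<close>
  means that the tester rejects after seeing the sample \<open>W\<close>.\<close>

definition sampling_reject_prob ::
    "nat \<Rightarrow> real \<Rightarrow> (nat set \<Rightarrow> (nat \<Rightarrow> 'a) \<Rightarrow> bool) \<Rightarrow> (nat \<Rightarrow> 'a) \<Rightarrow> real" where
  "sampling_reject_prob n p D x =
     measure_pmf.prob (random_subset n p) {W. D W (restrict x W)}"

definition one_sided_sampling_tester ::
    "nat \<Rightarrow> 'a set \<Rightarrow> (nat \<Rightarrow> 'a) set \<Rightarrow> real \<Rightarrow> real \<Rightarrow>
     (nat set \<Rightarrow> (nat \<Rightarrow> 'a) \<Rightarrow> bool) \<Rightarrow> bool" where
  "one_sided_sampling_tester n S P e p D \<longleftrightarrow>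
     p \<in> {0..1} \<and>
     (\<forall>x\<in>P. sampling_reject_prob n p D x = 0) \<and>
     (\<forall>x\<in>words n S. far n e x P \<longrightarrow> sampling_reject_prob n p D x \<ge> 2 / 3)"

definition expected_samples :: "nat \<Rightarrow> real \<Rightarrow> real" where
  "expected_samples n p = measure_pmf.expectation (random_subset n p) (\<lambda>W. real (card W))"

end

theory Submission imports Defs begin

text \<open>Let \<open>g v\<close> be the probability that the test queries \<open>v\<close>, and sort the coordinates into levels
  \<open>0, \<dots>, c\<close> by comparing \<open>g v\<close> with the powers of some \<open>\<rho> < 1\<close> of order \<open>n\<^sup>-\<^sup>1\<^sup>/\<^sup>c\<close>. Call a level \<open>i < c\<close>
  overfull for a test if some window \<open>(i, l]\<close> of levels contains at least \<open>l - i\<close> of its queries. A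
  covering argument shows that a test has at most as many overfull levels as queries, so some fixed
  level \<open>i\<close> is overfull with probability at most \<open>d / c\<close>. Let \<open>K\<close> consist of the coordinates of level
  at most \<open>i\<close>; it has at most \<open>d / \<rho>\<^sup>i\<close> elements, which is below \<open>\<epsilon> n / 2\<close>. Changing an
  \<open>\<epsilon>\<close>-far word on \<open>K\<close> in any way keeps it \<open>\<epsilon> / 2\<close>-far, so it is rejected with probability at
  least \<open>\<beta>\<close> by tests for which \<open>i\<close> is not overfull. For these tests the number of queries in each window
  balances the decay of \<open>g\<close>, and the random sample covers the part outside \<open>K\<close> of one of them except
  with probability exponentially small in \<open>\<rho>\<^sup>-\<^sup>i\<close>. A union bound over the assignments to \<open>K\<close> then
  rules out every word of the property that is consistent with the sample.\<close>

section \<open>Exponential bound for a random sample containing no edge of a hypergraph\<close>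

lemma prob_Pi_bernoulli_insert:
  assumes "finite A" "x \<notin> A" "0 \<le> p" "p \<le> 1"
  shows "measure_pmf.prob (Pi_pmf (insert x A) False (\<lambda>_. bernoulli_pmf p)) E =
    p * measure_pmf.prob (Pi_pmf A False (\<lambda>_. bernoulli_pmf p)) {b. b(x := True) \<in> E} +
    (1 - p) * measure_pmf.prob (Pi_pmf A False (\<lambda>_. bernoulli_pmf p)) {b. b(x := False) \<in> E}"
proof -
  define M where "M = Pi_pmf A False (\<lambda>_. bernoulli_pmf p)"
  have *: "emeasure (measure_pmf (bind_pmf M (\<lambda>f. return_pmf (f(x := c))))) E
      = ennreal (measure_pmf.prob M {b. b(x := c) \<in> E})" for c
  proof -
    have "bind_pmf M (\<lambda>f. return_pmf (f(x := c))) = map_pmf (\<lambda>f. f(x := c)) M"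
      by (simp add: map_pmf_def)
    then show ?thesis
      by (simp add: measure_pmf.emeasure_eq_measure vimage_def)
  qed
  have "ennreal (measure_pmf.prob (Pi_pmf (insert x A) False (\<lambda>_. bernoulli_pmf p)) E) =
    emeasure (measure_pmf (bind_pmf (bernoulli_pmf p) (\<lambda>y. bind_pmf M (\<lambda>f. return_pmf (f(x := y)))))) E"
    unfolding M_def by (subst Pi_pmf_insert'[OF assms(1,2)]) (simp only: measure_pmf.emeasure_eq_measure)
  also have "\<dots> = ennreal (measure_pmf.prob M {b. b(x := True) \<in> E}) * ennreal p +
      ennreal (measure_pmf.prob M {b. b(x := False) \<in> E}) * ennreal (1 - p)"
    by (subst emeasure_bind_pmf, subst nn_integral_bernoulli_pmf) (use assms * in auto)
  also have "\<dots> = ennreal (p * measure_pmf.prob M {b. b(x := True) \<in> E} +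
      (1 - p) * measure_pmf.prob M {b. b(x := False) \<in> E})"
    using assms by (simp add: ennreal_mult ennreal_plus mult.commute)
  finally show ?thesis
    unfolding M_def using assms by (subst (asm) ennreal_inj) auto
qed

lemma exp_minus_le_half:
  fixes y :: real
  assumes "0 \<le> y" "y \<le> 1"
  shows "exp (- y) \<le> 1 - y / 2"
proof -
  have "exp (- y) \<le> 1 / (1 + y)"
    using exp_ge_add_one_self[of y] assms by (simp add: exp_minus field_simps)
  also have "\<dots> \<le> 1 - y / 2"
    using assms mult_left_mono[of y 1 y] by (simp add: field_simps)
  finally show ?thesis .
qed

text \<open>One step of the supermartingale, with \<open>y\<close> the normalised weight gain when a
  vertex is sampled. The halved exponent comes from \<open>exp (- y) \<le> 1 - y / 2\<close> and is
  what the factor 2 in \<open>2 / p\<close> compensates.\<close>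

lemma bernoulli_exp_bound:
  fixes p y :: real
  assumes "0 \<le> p" "0 \<le> y" "y \<le> 1"
  shows "1 - p + p * exp (- y) \<le> exp (- (p * y / 2))"
proof -
  have "1 - p + p * exp (- y) \<le> 1 + - (p * y / 2)"
    using mult_left_mono[OF exp_minus_le_half[OF assms(2,3)] assms(1)] by (simp add: algebra_simps)
  also have "\<dots> \<le> exp (- (p * y / 2))"
    by (rule exp_ge_add_one_self)
  finally show ?thesis .
qed

text \<open>The vertices are exposed in order of \<open>r\<close>. A sampled vertex multiplies the weight of its edges by
  \<open>2 / p\<close>, an unsampled one deletes them; the factor \<open>2\<close> beyond the unbiased \<open>1 / p\<close> makes \<open>exp (- weight / B)\<close>
  a supermartingale as long as each exposed vertex changes the weight by at most \<open>B\<close>.\<close>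

lemma prob_no_edge_sampled_le:
  fixes F :: "'i \<Rightarrow> 'v set" and w :: "'i \<Rightarrow> real" and r :: "'v \<Rightarrow> nat"
  assumes "finite V" "finite I" and p: "0 < p" "p \<le> 1" and B: "0 < B"
    and "\<And>t. t \<in> I \<Longrightarrow> F t \<subseteq> V" "\<And>t. t \<in> I \<Longrightarrow> 0 \<le> w t"
    and "\<And>v. v \<in> V \<Longrightarrow>
      (\<Sum>t | t \<in> I \<and> v \<in> F t. w t * (2 / p) ^ card {u \<in> F t. r u \<le> r v}) \<le> B"
  shows "measure_pmf.prob (Pi_pmf V False (\<lambda>_. bernoulli_pmf p)) {b. \<forall>t\<in>I. \<exists>v\<in>F t. \<not> b v}
    \<le> exp (- (\<Sum>t\<in>I. w t) / B)"
proof -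
  \<comment> \<open>The ranking induction adds an element of largest \<open>f\<close>, so the added
    vertex has the smallest \<open>r\<close> and is the one exposed first.\<close>
  define f where "f v = - int (r v)" for v
  show ?thesis
    using assms(1,2,6-8)
  proof (induction V arbitrary: I F w rule: finite_ranking_induct[where f = f])
    case empty
    show ?case
    proof (cases "I = {}")
      case False
      with empty.prems(2) have "{b. \<forall>t\<in>I. \<exists>v\<in>F t. \<not> b v} = {}" by blast
      then show ?thesis by (simp only: measure_empty exp_ge_zero)
    qed simp
  next
    case (insert x V)
    show ?case
    proof (cases "x \<in> V")
      case True
      then show ?thesis
        using insert.IH[of I F w] insert.prems by (simp add: insert_absorb)
    next
      case False
      have min: "r x \<le> r v" if "v \<in> V" for v
        using insert.hyps(2)[OF that] by (simp add: f_def)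
      define I0 where "I0 = {t \<in> I. x \<notin> F t}"
      define I1 where "I1 = {t \<in> I. x \<in> F t}"
      have I: "I = I0 \<union> I1" "I0 \<inter> I1 = {}" "finite I0" "finite I1"
        using insert.prems(1) by (auto simp: I0_def I1_def)
      define F' where "F' t = F t - {x}" for t
      \<comment> \<open>Sampling \<open>x\<close> removes one vertex from each edge through it, and
        the weight takes over the lost factor \<open>2 / p\<close>. Hence the load at every
        remaining vertex is unchanged.\<close>
      define w' where "w' t = (if x \<in> F t then w t * (2 / p) else w t)" for t
      define C where "C = (\<Sum>t\<in>I1. w t)"
      define R where "R = (\<Sum>t\<in>I0. w t)"
      have finF: "finite (F t)" if "t \<in> I" for t
        using insert.prems(2)[OF that] insert.hyps(1) finite_subset by blast
      have pge: "1 \<le> 2 / p" using p by simp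
      have C0: "0 \<le> C" unfolding C_def using insert.prems(3) by (intro sum_nonneg) (auto simp: I1_def)
      have CB: "C * (2 / p) \<le> B"
      proof -
        have "C * (2 / p) \<le> (\<Sum>t\<in>I1. w t * (2 / p) ^ card {u \<in> F t. r u \<le> r x})"
          unfolding C_def sum_distrib_right
        proof (intro sum_mono mult_left_mono)
          fix t assume t: "t \<in> I1"
          then have "finite {u \<in> F t. r u \<le> r x}" "x \<in> {u \<in> F t. r u \<le> r x}"
            using finF by (auto simp: I1_def)
          then have "1 \<le> card {u \<in> F t. r u \<le> r x}"
            by (metis One_nat_def Suc_leI card_gt_0_iff empty_iff)
          then show "2 / p \<le> (2 / p) ^ card {u \<in> F t. r u \<le> r x}"
            using power_increasing[OF _ pge] by fastforce
          show "0 \<le> w t" using t insert.prems(3) by (auto simp: I1_def)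
        qed
        also have "\<dots> \<le> B"
          using insert.prems(4)[of x] by (simp add: I1_def)
        finally show ?thesis .
      qed
      \<comment> \<open>If \<open>x\<close> is not sampled, each edge through it already has its
        unsampled vertex, so only \<open>I0\<close> still imposes a constraint.\<close>
      have unhit: "measure_pmf.prob (Pi_pmf V False (\<lambda>_. bernoulli_pmf p))
          {b. \<forall>t\<in>I0. \<exists>v\<in>F t. \<not> b v} \<le> exp (- R / B)"
        unfolding R_def
      proof (rule insert.IH)
        fix v assume v: "v \<in> V"
        have "(\<Sum>t | t \<in> I0 \<and> v \<in> F t. w t * (2 / p) ^ card {u \<in> F t. r u \<le> r v})
          \<le> (\<Sum>t | t \<in> I \<and> v \<in> F t. w t * (2 / p) ^ card {u \<in> F t. r u \<le> r v})"
          using insert.prems(1,3) p by (intro sum_mono2) (auto simp: I0_def)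
        also have "\<dots> \<le> B" using insert.prems(4)[of v] v by simp
        finally show "(\<Sum>t | t \<in> I0 \<and> v \<in> F t. w t * (2 / p) ^ card {u \<in> F t. r u \<le> r v}) \<le> B" .
      qed (use insert.prems(2,3) I(3) in \<open>auto simp: I0_def\<close>)
      have hit: "measure_pmf.prob (Pi_pmf V False (\<lambda>_. bernoulli_pmf p))
          {b. \<forall>t\<in>I. \<exists>v\<in>F' t. \<not> b v} \<le> exp (- (\<Sum>t\<in>I. w' t) / B)"
      proof (rule insert.IH)
        fix v assume v: "v \<in> V"
        have "(\<Sum>t | t \<in> I \<and> v \<in> F' t. w' t * (2 / p) ^ card {u \<in> F' t. r u \<le> r v})
          = (\<Sum>t | t \<in> I \<and> v \<in> F t. w t * (2 / p) ^ card {u \<in> F t. r u \<le> r v})"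
        proof (rule sum.cong)
          show "{t. t \<in> I \<and> v \<in> F' t} = {t. t \<in> I \<and> v \<in> F t}"
            using v False by (auto simp: F'_def)
          fix t assume t: "t \<in> {t. t \<in> I \<and> v \<in> F t}"
          show "w' t * (2 / p) ^ card {u \<in> F' t. r u \<le> r v}
            = w t * (2 / p) ^ card {u \<in> F t. r u \<le> r v}"
          proof (cases "x \<in> F t")
            case True
            have "{u \<in> F t. r u \<le> r v} = insert x {u \<in> F' t. r u \<le> r v}"
              using True min[OF v] by (auto simp: F'_def)
            moreover have "finite {u \<in> F' t. r u \<le> r v}" using finF t by (auto simp: F'_def)
            ultimately have "card {u \<in> F t. r u \<le> r v} = Suc (card {u \<in> F' t. r u \<le> r v})"
              by (simp add: F'_def)
            then show ?thesis using True by (simp add: w'_def)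
          qed (simp add: w'_def F'_def)
        qed
        also have "\<dots> \<le> B" using insert.prems(4)[of v] v by simp
        finally show "(\<Sum>t | t \<in> I \<and> v \<in> F' t. w' t * (2 / p) ^ card {u \<in> F' t. r u \<le> r v}) \<le> B" .
      qed (use insert.prems(1,2,3) p in \<open>auto simp: F'_def w'_def\<close>)
      have w'sum: "(\<Sum>t\<in>I. w' t) = R + C * (2 / p)"
      proof -
        have "(\<Sum>t\<in>I. w' t) = (\<Sum>t\<in>I0. w' t) + (\<Sum>t\<in>I1. w' t)"
          using I by (simp add: sum.union_disjoint)
        also have "(\<Sum>t\<in>I0. w' t) = R" unfolding R_def by (intro sum.cong) (auto simp: I0_def w'_def)
        also have "(\<Sum>t\<in>I1. w' t) = C * (2 / p)"
          unfolding C_def sum_distrib_right by (intro sum.cong) (auto simp: I1_def w'_def)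
        finally show ?thesis .
      qed
      have wsum: "(\<Sum>t\<in>I. w t) = R + C"
        using I by (simp add: sum.union_disjoint R_def C_def)
      \<comment> \<open>Here \<open>y \<le> 1\<close> is the load condition at \<open>x\<close>, and
        \<open>p * y / 2 = C / B\<close> restores exactly the weight by which \<open>R\<close> falls
        short of the total.\<close>
      define y where "y = C * (2 / p) / B"
      have y: "0 \<le> y" "y \<le> 1" "p * y / 2 = C / B"
        using C0 CB B p by (simp_all add: y_def pos_divide_le_eq mult.commute)
      have e1: "{b. b(x := True) \<in> {b. \<forall>t\<in>I. \<exists>v\<in>F t. \<not> b v}} = {b. \<forall>t\<in>I. \<exists>v\<in>F' t. \<not> b v}"
        by (auto simp: F'_def)
      have e2: "{b. b(x := False) \<in> {b. \<forall>t\<in>I. \<exists>v\<in>F t. \<not> b v}} = {b. \<forall>t\<in>I0. \<exists>v\<in>F t. \<not> b v}"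
        by (auto simp: I0_def)
      have "measure_pmf.prob (Pi_pmf (insert x V) False (\<lambda>_. bernoulli_pmf p))
          {b. \<forall>t\<in>I. \<exists>v\<in>F t. \<not> b v}
        \<le> p * exp (- (R + C * (2 / p)) / B) + (1 - p) * exp (- R / B)"
        unfolding prob_Pi_bernoulli_insert[OF insert.hyps(1) False less_imp_le[OF p(1)] p(2)] e1 e2
        using hit unhit p by (intro add_mono mult_left_mono) (auto simp: w'sum)
      also have "\<dots> = exp (- R / B) * (1 - p + p * exp (- y))"
        by (simp add: y_def algebra_simps add_divide_distrib diff_divide_distrib flip: exp_add)
      also have "\<dots> \<le> exp (- R / B) * exp (- (p * y / 2))"
        using p y by (intro mult_left_mono bernoulli_exp_bound) auto
      also have "\<dots> = exp (- (\<Sum>t\<in>I. w t) / B)"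
        unfolding y(3) wsum by (simp add: add_divide_distrib diff_divide_distrib flip: exp_add)
      finally show ?thesis .
    qed
  qed
qed

section \<open>Overfull levels and the covering argument\<close>

text \<open>If \<open>i\<close> is not overfull, a window \<open>(i, l]\<close> holds at most
  \<open>l - i - 1\<close> queries. This is also the number of factors \<open>\<rho>\<close> by
  which \<open>g\<close> at level \<open>l\<close> is guaranteed to lie below
  \<open>\<rho> ^ i\<close>.\<close>

definition overfull :: "('v \<Rightarrow> nat) \<Rightarrow> nat \<Rightarrow> 'v set \<Rightarrow> nat \<Rightarrow> bool" where
  "overfull r c Q i \<longleftrightarrow>
     (\<exists>l. i < l \<and> l \<le> c \<and> l - i \<le> card {v \<in> Q. i < r v \<and> r v \<le> l})"

text \<open>Scan the levels upwards. At an overfull level \<open>m\<close>, the queries in a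
  witnessing window up to \<open>l\<close> pay for all levels in \<open>{m..<l}\<close>, and the
  scan resumes at \<open>l\<close>. The windows used are disjoint, so no query pays twice.\<close>

lemma card_overfull_le:
  assumes "finite Q"
  shows "card {i. i < c \<and> overfull r c Q i} \<le> card Q"
proof -
  define bad where "bad i \<longleftrightarrow> overfull r c Q i" for i
  \<comment> \<open>An arbitrary starting level \<open>m\<close>, with only queries above
    \<open>m\<close> counted, lets the scan resume at the end of a window.\<close>
  have "card {i. m \<le> i \<and> i < c \<and> bad i} \<le> card {v \<in> Q. m < r v}" for m
  proof (induction "c - m" arbitrary: m rule: less_induct)
    case less
    consider "c \<le> m" | "m < c" "\<not> bad m" | "m < c" "bad m" by linarith
    then show ?case
    proof cases
      case 1
      then have "{i. m \<le> i \<and> i < c \<and> bad i} = {}" by auto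
      then show ?thesis by (simp only: card.empty)
    next
      case 2
      then have "{i. m \<le> i \<and> i < c \<and> bad i} = {i. Suc m \<le> i \<and> i < c \<and> bad i}"
        by (auto simp: Suc_le_eq) (metis le_neq_implies_less)
      also have "card \<dots> \<le> card {v \<in> Q. Suc m < r v}"
        using 2 by (intro less) auto
      also have "\<dots> \<le> card {v \<in> Q. m < r v}"
        using assms by (intro card_mono) auto
      finally show ?thesis .
    next
      case 3
      then obtain l where l: "m < l" "l \<le> c" "l - m \<le> card {v \<in> Q. m < r v \<and> r v \<le> l}"
        unfolding bad_def overfull_def by blast
      have "card {i. m \<le> i \<and> i < c \<and> bad i} \<le> card ({m..<l} \<union> {i. l \<le> i \<and> i < c \<and> bad i})"
        by (intro card_mono) auto
      also have "\<dots> \<le> (l - m) + card {i. l \<le> i \<and> i < c \<and> bad i}"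
        using card_Un_le by (metis card_atLeastLessThan)
      also have "\<dots> \<le> card {v \<in> Q. m < r v \<and> r v \<le> l} + card {v \<in> Q. l < r v}"
        using l less[of l] 3 by (intro add_mono) auto
      also have "\<dots> = card ({v \<in> Q. m < r v \<and> r v \<le> l} \<union> {v \<in> Q. l < r v})"
        using assms by (intro card_Un_disjoint[symmetric]) auto
      also have "\<dots> \<le> card {v \<in> Q. m < r v}"
        using assms l by (intro card_mono) auto
      finally show ?thesis .
    qed
  qed
  from this[of 0] have "card {i. i < c \<and> bad i} \<le> card {v \<in> Q. 0 < r v}" by simp
  also have "\<dots> \<le> card Q" using assms by (intro card_mono) auto
  finally show ?thesis unfolding bad_def .
qed

section \<open>Distances and expected sample size\<close>

lemma far_iff:
  assumes "finite P"
  shows "far n e x P \<longleftrightarrow> (\<forall>z\<in>P. e < word_dist n x z)"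
  using assms by (auto simp: far_def dist_to_def)

lemma word_dist_le_add_card:
  assumes "\<And>i. i \<in> {1..n} \<Longrightarrow> i \<notin> K \<Longrightarrow> x i = y i" "finite K"
  shows "word_dist n x z \<le> word_dist n y z + real (card K) / real n"
proof -
  have "card {i \<in> {1..n}. x i \<noteq> z i} \<le> card ({i \<in> {1..n}. y i \<noteq> z i} \<union> K)"
    using assms by (intro card_mono) auto
  also have "\<dots> \<le> card {i \<in> {1..n}. y i \<noteq> z i} + card K" by (rule card_Un_le)
  finally show ?thesis
    unfolding word_dist_def add_divide_distrib[symmetric]
    by (intro divide_right_mono) auto
qed

lemma expected_samples_eq:
  assumes "0 \<le> p" "p \<le> 1"
  shows "expected_samples n p = real n * p"
proof -
  define M where "M = Pi_pmf {1..n} False (\<lambda>_. bernoulli_pmf p)"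
  have fin: "finite (set_pmf M)"
    unfolding M_def by (subst set_Pi_pmf) (auto intro!: finite_PiE_dflt)
  have *: "measure_pmf.expectation M (\<lambda>b. of_bool (b i)) = p" if "i \<in> {1..n}" for i
  proof -
    have "measure_pmf.expectation M (\<lambda>b. of_bool (b i)) =
      measure_pmf.expectation (map_pmf (\<lambda>b. b i) M) (of_bool :: bool \<Rightarrow> real)" by simp
    also have "map_pmf (\<lambda>b. b i) M = bernoulli_pmf p"
      unfolding M_def using that by (subst Pi_pmf_component) auto
    finally show ?thesis using assms by simp
  qed
  have "expected_samples n p = measure_pmf.expectation M (\<lambda>b. \<Sum>i\<in>{1..n}. of_bool (b i))"
    unfolding expected_samples_def random_subset_def M_def[symmetric]
    by (simp add: Int_def)
  also have "\<dots> = (\<Sum>i\<in>{1..n}. measure_pmf.expectation M (\<lambda>b. of_bool (b i)))"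
    by (intro Bochner_Integration.integral_sum integrable_measure_pmf_finite fin)
  also have "\<dots> = real n * p" using * by simp
  finally show ?thesis .
qed

section \<open>Averaging over the levels\<close>

lemma sum_filter_eq_sum_of_bool:
  fixes f :: "'i \<Rightarrow> real"
  assumes "finite A"
  shows "(\<Sum>t | t \<in> A \<and> P t. f t) = (\<Sum>t\<in>A. of_bool (P t) * f t)"
proof -
  have "{t. t \<in> A \<and> P t} = A \<inter> {t. P t}" by blast
  then show ?thesis using assms by simp
qed

text \<open>By the covering bound, the expected number of overfull levels is at most the expected
  number of queries, so the smallest of the \<open>c\<close> probabilities is at most a
  \<open>c\<close>-th of it.\<close>

lemma exists_level_rarely_overfull:
  fixes M :: "'i pmf"
  assumes "finite A" "set_pmf M \<subseteq> A" "\<And>t. t \<in> A \<Longrightarrow> finite (Q t)" "0 < c"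
  shows "\<exists>i<c. measure_pmf.prob M {t \<in> A. overfull r c (Q t) i}
    \<le> measure_pmf.expectation M (\<lambda>t. real (card (Q t))) / real c"
proof (rule ccontr)
  define D where "D = measure_pmf.expectation M (\<lambda>t. real (card (Q t)))"
  assume "\<not> ?thesis"
  then have *: "D / real c < measure_pmf.prob M {t \<in> A. overfull r c (Q t) i}" if "i < c" for i
    using that unfolding D_def by (meson not_le)
  have "D = (\<Sum>i<c. D / real c)" using assms by simp
  also have "\<dots> < (\<Sum>i<c. measure_pmf.prob M {t \<in> A. overfull r c (Q t) i})"
    using assms * by (intro sum_strict_mono) auto
  also have "\<dots> = (\<Sum>i<c. \<Sum>t\<in>A. of_bool (overfull r c (Q t) i) * pmf M t)"
    using assms(1) by (simp add: measure_measure_pmf_finite sum_filter_eq_sum_of_bool)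
  also have "\<dots> = (\<Sum>t\<in>A. (\<Sum>i<c. of_bool (overfull r c (Q t) i)) * pmf M t)"
    by (subst sum.swap) (simp add: sum_distrib_right)
  also have "\<dots> = (\<Sum>t\<in>A. real (card {i. i < c \<and> overfull r c (Q t) i}) * pmf M t)"
    by (simp add: Int_def)
  also have "\<dots> \<le> (\<Sum>t\<in>A. real (card (Q t)) * pmf M t)"
    using assms by (intro sum_mono mult_right_mono) (auto simp: card_overfull_le)
  also have "\<dots> = D"
    unfolding D_def using assms by (intro integral_measure_pmf_real[symmetric]) auto
  finally show False by simp
qed

section \<open>Levels defined by query probabilities\<close>

text \<open>For \<open>\<rho>\<close> in (0, 1] the counted \<open>j\<close> form an initial
  segment, so this is the first \<open>j\<close> with \<open>\<rho> ^ j \<le> g v\<close>, capped at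
  \<open>c\<close>. Frequently queried coordinates get low levels.\<close>

definition level :: "real \<Rightarrow> nat \<Rightarrow> ('v \<Rightarrow> real) \<Rightarrow> 'v \<Rightarrow> nat" where
  "level \<rho> c g v = card {j. j < c \<and> g v < \<rho> ^ j}"

lemma level_le: "level \<rho> c g v \<le> c"
proof -
  have "level \<rho> c g v \<le> card {..<c}"
    unfolding level_def by (intro card_mono) auto
  then show ?thesis by simp
qed

lemma less_level_iff:
  assumes "0 < \<rho>" "\<rho> \<le> 1" "i < c"
  shows "i < level \<rho> c g v \<longleftrightarrow> g v < \<rho> ^ i"
proof
  assume less: "g v < \<rho> ^ i"
  have "g v < \<rho> ^ j" if "j \<le> i" for j
    using less power_decreasing[OF that, of \<rho>] assms by linarith
  then have "card {..i} \<le> level \<rho> c g v"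
    unfolding level_def using assms by (intro card_mono) auto
  then show "i < level \<rho> c g v" by simp
next
  assume less: "i < level \<rho> c g v"
  show "g v < \<rho> ^ i"
  proof (rule ccontr)
    assume ge: "\<not> g v < \<rho> ^ i"
    have "\<not> g v < \<rho> ^ j" if "i \<le> j" for j
      using ge power_decreasing[OF that, of \<rho>] assms by linarith
    then have "{j. j < c \<and> g v < \<rho> ^ j} \<subseteq> {..<i}"
      using not_le by blast
    then have "level \<rho> c g v \<le> card {..<i}"
      unfolding level_def by (intro card_mono) auto
    with less show False by simp
  qed
qed

section \<open>Union bound for a fixed far word\<close>

text \<open>The scale \<open>\<rho>\<close> is left free. The exponent \<open>c - 1\<close> keeps
  \<open>K\<close> small for whichever level \<open>i < c\<close> the averaging selects; the last
  bound on \<open>2 * \<rho> / p\<close> closes the union bound over assignments to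
  \<open>K\<close>.\<close>

lemma prob_inconsistent_sample_ge:
  fixes T :: "('a, 'i) tester"
  assumes n: "0 < n" and c: "0 < c" and S: "finite S" and P: "P \<subseteq> words n S"
    and T: "nonadaptive_tester n T" "one_sided T P"
    and \<delta>: "\<And>x. x \<in> words n S \<Longrightarrow> far n (\<epsilon> / 2) x P \<Longrightarrow> \<delta> \<le> reject_prob T x"
    and \<beta>: "\<beta> = \<delta> - avg_queries T / real c" "0 < \<beta>"
    and \<rho>: "0 < \<rho>" "\<rho> \<le> 1" "avg_queries T / \<rho> ^ (c - 1) \<le> \<epsilon> / 2 * real n"
    and p: "0 < p" "p \<le> 1" "2 * \<rho> / p \<le> 1"
      "2 * \<rho> / p * (avg_queries T * ln (card S) + ln 3) \<le> \<beta>"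
    and x: "x \<in> words n S" "far n \<epsilon> x P"
  shows "2 / 3 \<le> sampling_reject_prob n p (\<lambda>W u. \<not> (\<exists>z\<in>P. restrict z W = u)) x"
proof -
  define A where "A = tests T"
  define M where "M = distribution T"
  define Q where "Q = queries T"
  define d where "d = avg_queries T"
  define \<eta> where "\<eta> = 2 * \<rho> / p"
  note defs = A_def M_def Q_def d_def
  have A: "finite A" "set_pmf M \<subseteq> A" "\<And>t. t \<in> A \<Longrightarrow> Q t \<subseteq> {1..n}"
    using T(1) by (auto simp: nonadaptive_tester_def defs)
  have finQ: "finite (Q t)" if "t \<in> A" for t
    using A(3)[OF that] finite_subset by blast
  have d: "d = (\<Sum>t\<in>A. real (card (Q t)) * pmf M t)"
    unfolding d_def avg_queries_def M_def[symmetric] Q_def[symmetric]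
    using A by (intro integral_measure_pmf_real) auto
  have d0: "0 \<le> d" unfolding d by (intro sum_nonneg) auto
  define g where "g v = (\<Sum>t | t \<in> A \<and> v \<in> Q t. pmf M t)" for v
  have g0: "0 \<le> g v" for v unfolding g_def by (intro sum_nonneg) auto
  have gsum: "(\<Sum>v\<in>{1..n}. g v) = d"
  proof -
    have "(\<Sum>v\<in>{1..n}. g v) = (\<Sum>v\<in>{1..n}. \<Sum>t\<in>A. of_bool (v \<in> Q t) * pmf M t)"
      unfolding g_def by (simp only: sum_filter_eq_sum_of_bool[OF A(1)])
    also have "\<dots> = (\<Sum>t\<in>A. (\<Sum>v\<in>{1..n}. of_bool (v \<in> Q t)) * pmf M t)"
      by (subst sum.swap) (simp add: sum_distrib_right)
    also have "\<dots> = d"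
      unfolding d
    proof (intro sum.cong refl)
      fix t assume "t \<in> A"
      then have "{1..n} \<inter> {v. v \<in> Q t} = Q t" using A(3) by auto
      then show "(\<Sum>v\<in>{1..n}. of_bool (v \<in> Q t)) * pmf M t = real (card (Q t)) * pmf M t"
        by simp
    qed
    finally show ?thesis .
  qed
  define r where "r = level \<rho> c g"
  obtain i where i: "i < c" "measure_pmf.prob M {t \<in> A. overfull r c (Q t) i} \<le> d / real c"
    using exists_level_rarely_overfull[OF A(1,2) _ c, where r = r and Q = Q] finQ
    unfolding d_def avg_queries_def defs by auto
  define K where "K = {v \<in> {1..n}. r v \<le> i}"
  have finK: "finite K" by (simp add: K_def)
  \<comment> \<open>Markov's inequality: \<open>g\<close> is at least \<open>\<rho> ^ i\<close> on
    \<open>K\<close> and sums to \<open>d\<close>.\<close>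
  have cardK: "real (card K) \<le> d / \<rho> ^ i"
  proof -
    have "real (card K) * \<rho> ^ i = (\<Sum>v\<in>K. \<rho> ^ i)" by simp
    also have "\<dots> \<le> (\<Sum>v\<in>K. g v)"
      using less_level_iff[OF \<rho>(1,2) i(1), of g]
      by (intro sum_mono) (auto simp: K_def r_def simp flip: not_less)
    also have "\<dots> \<le> d"
      unfolding gsum[symmetric] using g0 by (intro sum_mono2) (auto simp: K_def)
    finally show ?thesis using \<rho> by (simp add: field_simps)
  qed
  have cardK': "real (card K) / real n \<le> \<epsilon> / 2"
  proof -
    have "d / \<rho> ^ i \<le> d / \<rho> ^ (c - 1)"
      using d0 \<rho> i power_decreasing[of i "c - 1" \<rho>] by (intro divide_left_mono) auto
    with cardK \<rho>(3) have "real (card K) \<le> \<epsilon> / 2 * real n" unfolding d_def by linarith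
    then show ?thesis using n by (simp add: field_simps)
  qed
  define B where "B = \<rho> ^ i * \<eta>"
  have \<eta>: "0 < \<eta>" "\<eta> \<le> 1" using p \<rho> by (auto simp: \<eta>_def)
  have B: "0 < B" using \<rho> \<eta> by (simp add: B_def)
  define F where "F t = Q t - K" for t
  define y where "y s v = (if v \<in> K then s v else x v)" for s and v :: nat
  \<comment> \<open>Positive probability is demanded so that one-sidedness forbids each single test
    of \<open>I s\<close> from rejecting a word of \<open>P\<close>.\<close>
  define I where "I s =
    {t \<in> A. rejects T t (restrict (y s) (Q t)) \<and> \<not> overfull r c (Q t) i \<and> 0 < pmf M t}" for s
  define E where "E s = {b. \<forall>t\<in>I s. \<exists>v\<in>F t. \<not> b v}" for s
  define N where "N = Pi_pmf {1..n} False (\<lambda>_. bernoulli_pmf p)"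
  \<comment> \<open>With \<open>k = r v - i - 1\<close>, the window up to \<open>r v\<close> gives
    at most \<open>k\<close> factors \<open>2 / p\<close>, while
    \<open>g v < \<rho> ^ (i + k)\<close>. The load is thus at most
    \<open>\<rho> ^ i * \<eta> ^ k\<close>.\<close>
  have load: "(\<Sum>t | t \<in> I s \<and> v \<in> F t. pmf M t * (2 / p) ^ card {u \<in> F t. r u \<le> r v}) \<le> B"
    if "v \<in> {1..n}" for s v
  proof (cases "{t. t \<in> I s \<and> v \<in> F t} = {}")
    case True
    then show ?thesis using B by (simp only: sum.empty less_imp_le)
  next
    case False
    have vi: "i < r v" "r v \<le> c" using False that
      by (auto simp: F_def K_def r_def level_le)
    have count: "card {u \<in> F t. r u \<le> r v} < r v - i" if "t \<in> I s" for t
    proof -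
      have "{u \<in> F t. r u \<le> r v} = {u \<in> Q t. i < r u \<and> r u \<le> r v}"
        using that A(3)[of t] by (auto simp: F_def K_def I_def)
      then show ?thesis using that vi by (auto simp: I_def overfull_def not_le)
    qed
    \<comment> \<open>The vertex \<open>v\<close> lies in its own window, so a window that is not
      overfull has length at least 2. Hence \<open>k \<ge> 1\<close> and at least one factor
      \<open>\<eta>\<close> remains.\<close>
    have two: "2 \<le> r v - i"
    proof -
      obtain t where t: "t \<in> I s" "v \<in> F t" using False by blast
      then have "finite {u \<in> F t. r u \<le> r v}" "v \<in> {u \<in> F t. r u \<le> r v}"
        using finQ by (auto simp: I_def F_def)
      then have "0 < card {u \<in> F t. r u \<le> r v}" by (metis card_gt_0_iff empty_iff)
      with count[OF t(1)] show ?thesis by linarith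
    qed
    define k where "k = r v - i - 1"
    have k: "1 \<le> k" "r v - 1 = i + k" using two by (auto simp: k_def)
    have "(\<Sum>t | t \<in> I s \<and> v \<in> F t. pmf M t * (2 / p) ^ card {u \<in> F t. r u \<le> r v})
      \<le> (\<Sum>t | t \<in> I s \<and> v \<in> F t. pmf M t * (2 / p) ^ k)"
    proof (intro sum_mono mult_left_mono power_increasing)
      fix t assume "t \<in> {t. t \<in> I s \<and> v \<in> F t}"
      then show "card {u \<in> F t. r u \<le> r v} \<le> k" using count[of t] by (auto simp: k_def)
    qed (use p in auto)
    also have "\<dots> \<le> g v * (2 / p) ^ k"
      unfolding g_def sum_distrib_right[symmetric]
      using A p by (intro mult_right_mono sum_mono2) (auto simp: I_def F_def)
    also have "\<dots> \<le> \<rho> ^ (r v - 1) * (2 / p) ^ k"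
    proof -
      have "r v - 1 < c" "r v - 1 < r v" using vi by auto
      then have "g v < \<rho> ^ (r v - 1)"
        using less_level_iff[OF \<rho>(1,2), of "r v - 1" c g v] by (simp only: r_def)
      then show ?thesis using p by (intro mult_right_mono) auto
    qed
    also have "\<dots> = \<rho> ^ i * \<eta> ^ k"
      unfolding k(2) \<eta>_def by (simp add: power_add power_mult_distrib power_divide)
    also have "\<dots> \<le> B"
      unfolding B_def using \<eta> \<rho> power_decreasing[OF k(1), of \<eta>] by (intro mult_left_mono) auto
    finally show ?thesis .
  qed
  have prob_E: "measure_pmf.prob N (E s) \<le> exp (- \<beta> / B)" if s: "s \<in> K \<rightarrow>\<^sub>E S" for s
  proof -
    have yw: "y s \<in> words n S"
      using x(1) s by (auto simp: words_def y_def K_def PiE_iff extensional_def)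
    have finP: "finite P"
      by (rule finite_subset[OF P]) (simp add: words_def finite_PiE S)
    have "far n (\<epsilon> / 2) (y s) P"
      unfolding far_iff[OF finP]
    proof
      fix z assume "z \<in> P"
      then have "\<epsilon> < word_dist n x z" using x(2) far_iff[OF finP] by blast
      also have "\<dots> \<le> word_dist n (y s) z + real (card K) / real n"
        using finK by (intro word_dist_le_add_card) (auto simp: y_def)
      finally show "\<epsilon> / 2 < word_dist n (y s) z" using cardK' by linarith
    qed
    then have "\<delta> \<le> reject_prob T (y s)" using \<delta> yw by blast
    also have "\<dots> = measure_pmf.prob M {t \<in> A. rejects T t (restrict (y s) (Q t))}"
      by (simp add: reject_prob_def defs)
    also have "\<dots> \<le> measure_pmf.prob M
        ({t \<in> A. rejects T t (restrict (y s) (Q t)) \<and> \<not> overfull r c (Q t) i}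
          \<union> {t \<in> A. overfull r c (Q t) i})"
      by (intro measure_pmf.finite_measure_mono) auto
    also have "\<dots> \<le> measure_pmf.prob M
        {t \<in> A. rejects T t (restrict (y s) (Q t)) \<and> \<not> overfull r c (Q t) i} + d / real c"
      using i(2) by (intro order_trans[OF measure_Un_le]) auto
    finally have "\<beta> \<le> measure_pmf.prob M
        {t \<in> A. rejects T t (restrict (y s) (Q t)) \<and> \<not> overfull r c (Q t) i}"
      using \<beta>(1) by (simp add: d_def)
    also have "\<dots> = (\<Sum>t\<in>{t \<in> A. rejects T t (restrict (y s) (Q t)) \<and> \<not> overfull r c (Q t) i}. pmf M t)"
      using A by (intro measure_measure_pmf_finite) auto
    also have "\<dots> = (\<Sum>t\<in>I s. pmf M t)"
      using A by (intro sum.mono_neutral_right) (auto simp: I_def less_le)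
    finally have "- (\<Sum>t\<in>I s. pmf M t) / B \<le> - \<beta> / B"
      using B by (intro divide_right_mono) auto
    moreover have "measure_pmf.prob N (E s) \<le> exp (- (\<Sum>t\<in>I s. pmf M t) / B)"
      unfolding N_def E_def
      by (rule prob_no_edge_sampled_le[OF _ _ p(1,2) B _ _ load])
        (use A in \<open>auto simp: I_def F_def\<close>)
    ultimately show ?thesis by (meson exp_le_cancel_iff order_trans)
  qed
  define Z where "Z = {b. \<exists>z\<in>P. restrict z {v \<in> {1..n}. b v} = restrict x {v \<in> {1..n}. b v}}"
  have "Z \<subseteq> (\<Union>s\<in>K \<rightarrow>\<^sub>E S. E s)"
  proof
    fix b assume "b \<in> Z"
    then obtain z where z: "z \<in> P"
      "restrict z {v \<in> {1..n}. b v} = restrict x {v \<in> {1..n}. b v}"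
      by (auto simp: Z_def)
    have zx: "z v = x v" if "v \<in> {1..n}" "b v" for v
      using fun_cong[OF z(2), of v] that by simp
    have s: "restrict z K \<in> K \<rightarrow>\<^sub>E S"
      using z(1) P by (auto simp: words_def K_def PiE_iff)
    \<comment> \<open>If all of \<open>F t\<close> were sampled, the modified word would agree with
      \<open>z\<close> on \<open>Q t\<close>: on \<open>K\<close> by the choice of assignment,
      elsewhere because \<open>x\<close> and \<open>z\<close> agree on the sample. Then
      \<open>t\<close> would reject a word of \<open>P\<close>.\<close>
    have "b \<in> E (restrict z K)"
      unfolding E_def
    proof (safe, rule ccontr)
      fix t assume t: "t \<in> I (restrict z K)" and "\<not> (\<exists>v\<in>F t. \<not> b v)"
      then have b: "b v" if "v \<in> Q t" "v \<notin> K" for v using that by (auto simp: F_def)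
      have tA: "t \<in> A" using t by (simp add: I_def)
      have "restrict (y (restrict z K)) (Q t) = restrict z (Q t)"
      proof (rule restrict_ext)
        fix v assume v: "v \<in> Q t"
        then have "v \<in> {1..n}" using A(3)[OF tA] by blast
        then show "y (restrict z K) v = z v"
          using zx b[OF v] by (auto simp: y_def)
      qed
      then have "rejects T t (restrict z (queries T t))" "t \<in> tests T" "0 < pmf M t"
        using t by (auto simp: I_def defs)
      moreover have "pmf M t \<le> reject_prob T z"
        unfolding reject_prob_def measure_pmf_single[of "distribution T" t, symmetric] M_def
        using calculation by (intro measure_pmf.finite_measure_mono) auto
      ultimately show False using T(2) z(1) by (auto simp: one_sided_def)
    qed
    with s show "b \<in> (\<Union>s\<in>K \<rightarrow>\<^sub>E S. E s)" by blast
  qed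
  then have "measure_pmf.prob N Z \<le> measure_pmf.prob N (\<Union>s\<in>K \<rightarrow>\<^sub>E S. E s)"
    by (intro measure_pmf.finite_measure_mono) auto
  also have "\<dots> \<le> (\<Sum>s\<in>K \<rightarrow>\<^sub>E S. measure_pmf.prob N (E s))"
    using finK S by (intro measure_UNION_le finite_PiE) auto
  also have "\<dots> \<le> real (card (K \<rightarrow>\<^sub>E S)) * exp (- \<beta> / B)"
    using prob_E by (intro sum_bounded_above) auto
  also have "\<dots> = real (card S) ^ card K * exp (- \<beta> / B)"
    using finK by (simp add: card_PiE)
  also have "\<dots> \<le> 1 / 3"
  proof -
    have "x 1 \<in> S" using x(1) n by (auto simp: words_def PiE_iff)
    then have q: "1 \<le> card S" using S by (metis One_nat_def Suc_leI card_gt_0_iff empty_iff)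
    then have lnq: "0 \<le> ln (real (card S))" by simp
    \<comment> \<open>Replacing \<open>ln 3\<close> by \<open>ln 3 / \<rho> ^ i\<close> puts every
      term on the scale of \<open>\<beta> / B\<close>, so that \<open>i\<close> cancels from the
      required inequality.\<close>
    have "real (card K) * ln (card S) + ln 3 \<le> d / \<rho> ^ i * ln (card S) + ln 3 / \<rho> ^ i"
      using cardK lnq \<rho> power_le_one[of \<rho> i]
      by (intro add_mono mult_right_mono) (auto simp: field_simps)
    also have "\<dots> = (d * ln (card S) + ln 3) / \<rho> ^ i" by (simp add: add_divide_distrib)
    also have "\<dots> \<le> \<beta> / \<eta> / \<rho> ^ i"
      using p(4) \<rho> \<eta> unfolding d_def[symmetric] \<eta>_def[symmetric]
      by (intro divide_right_mono) (simp_all add: field_simps)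
    also have "\<dots> = \<beta> / B" by (simp add: B_def mult.commute)
    finally have le: "real (card K) * ln (card S) + - \<beta> / B \<le> - ln 3" by simp
    have "real (card S) ^ card K = exp (real (card K) * ln (card S))"
      using q by (simp add: exp_of_nat_mult)
    then have "real (card S) ^ card K * exp (- \<beta> / B) = exp (real (card K) * ln (card S) + - \<beta> / B)"
      by (simp only: exp_add)
    also have "\<dots> \<le> exp (- ln 3)" using le by (simp only: exp_le_cancel_iff)
    also have "\<dots> = 1 / 3" by (simp add: exp_minus)
    finally show ?thesis .
  qed
  finally have "measure_pmf.prob N Z \<le> 1 / 3" .
  moreover have "sampling_reject_prob n p (\<lambda>W u. \<not> (\<exists>z\<in>P. restrict z W = u)) x
      = measure_pmf.prob N (- Z)"
    unfolding sampling_reject_prob_def random_subset_def N_def[symmetric] Z_def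
    by (simp add: vimage_def Compl_eq)
  moreover have "measure_pmf.prob N (- Z) = 1 - measure_pmf.prob N Z"
    using measure_pmf.prob_compl[of Z N] by (simp add: Compl_eq_Diff_UNIV)
  ultimately show ?thesis by simp
qed

section \<open>Choice of the parameters\<close>

theorem theorem1p1:
  fixes q :: nat and \<epsilon> \<delta> d \<beta> \<alpha> :: real and c :: int
  assumes "0 < \<epsilon>" "\<epsilon> \<le> 1" and "0 < \<delta>" "\<delta> \<le> 1" and "0 < d"
    and "real_of_int c > d / \<delta>"
    and "\<beta> = \<delta> - d / real_of_int c"
    and "\<alpha> = 1 + 2 * d / \<beta> * (ln (real q) + ln 3)"
  shows "\<beta> > 0 \<and>
    (\<exists>n0::nat. \<forall>n\<ge>n0. \<forall>(S :: 'a set) (P :: (nat \<Rightarrow> 'a) set) (T :: ('a, 'i) tester).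
       finite S \<and> card S = q \<and> P \<subseteq> words n S \<and>
       nonadaptive_tester n T \<and> one_sided T P \<and> avg_queries T = d \<and>
       (\<forall>x\<in>words n S. far n (\<epsilon> / 2) x P \<longrightarrow> reject_prob T x \<ge> \<delta>)
       \<longrightarrow>
       (let p = \<alpha> * real n powr (- 1 / real_of_int c) in
          p \<le> 1 \<and>
          (\<exists>D. one_sided_sampling_tester n S P \<epsilon> p D) \<and>
          expected_samples n p = \<alpha> * real n powr (1 - 1 / real_of_int c)))"
proof -
  have c: "0 < real_of_int c"
    using assms(6) divide_pos_pos[OF \<open>0 < d\<close> \<open>0 < \<delta>\<close>] by linarith
  define C where "C = nat c"
  have C: "real C = real_of_int c" "0 < C" using c by (auto simp: C_def)
  have "d / real_of_int c < \<delta>"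
    using assms(6) c \<open>0 < \<delta>\<close> by (simp add: field_simps)
  then have \<beta>: "0 < \<beta>" by (simp add: assms(7))
  define L where "L = d * ln (real q) + ln 3"
  \<comment> \<open>The case \<open>q = 0\<close> relies on the convention
    \<open>ln 0 = 0\<close>.\<close>
  have lnq: "0 \<le> ln (real q)" by (cases q) auto
  have L: "0 < L"
    unfolding L_def using lnq \<open>0 < d\<close> by (intro add_nonneg_pos mult_nonneg_nonneg) auto
  have \<alpha>: "1 \<le> \<alpha>"
  proof -
    have "0 \<le> 2 * d / \<beta> * (ln (real q) + ln 3)"
      using lnq \<beta> \<open>0 < d\<close> by (intro mult_nonneg_nonneg add_nonneg_nonneg) auto
    then show ?thesis unfolding assms(8) by linarith
  qed
  \<comment> \<open>Later \<open>\<rho> = \<kappa> / m\<close> with \<open>m\<close> the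
    \<open>c\<close>-th root of \<open>n\<close>, so
    \<open>2 * \<rho> / p \<le> 2 * \<kappa>\<close> because \<open>\<alpha> \<ge> 1\<close>. The
    first entry makes this at most 1, the second makes the union bound close.\<close>
  define \<kappa> where "\<kappa> = min (1 / 2) (\<beta> / (2 * L))"
  have \<kappa>: "0 < \<kappa>" "\<kappa> \<le> 1 / 2" "2 * \<kappa> * L \<le> \<beta>"
    using \<beta> L by (auto simp: \<kappa>_def min_def field_simps)
  \<comment> \<open>Once \<open>m \<ge> m0\<close>, the first entry gives \<open>p \<le> 1\<close>.
    The second makes \<open>d / \<rho> ^ (C - 1)\<close>, of order \<open>m ^ (C - 1)\<close>, at
    most \<open>\<epsilon> / 2\<close> times \<open>n = m ^ C\<close>.\<close>
  define m0 where "m0 = max \<alpha> (2 * d / (\<epsilon> * \<kappa> ^ (C - 1)))"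
  have m0: "\<alpha> \<le> m0" "2 * d / (\<epsilon> * \<kappa> ^ (C - 1)) \<le> m0" by (auto simp: m0_def)
  define n0 where "n0 = nat \<lceil>m0 powr c\<rceil>"
  have main: "let p = \<alpha> * real n powr (- 1 / real_of_int c) in
      p \<le> 1 \<and> (\<exists>D. one_sided_sampling_tester n S P \<epsilon> p D) \<and>
      expected_samples n p = \<alpha> * real n powr (1 - 1 / real_of_int c)"
    if n0: "n0 \<le> n" and S: "finite S" "card S = q" and P: "P \<subseteq> words n S"
      and T: "nonadaptive_tester n T" "one_sided T P" "avg_queries T = d"
      and far: "\<forall>x\<in>words n S. far n (\<epsilon> / 2) x P \<longrightarrow> \<delta> \<le> reject_prob T x"
    for n and S :: "'a set" and P and T :: "('a, 'i) tester"
  proof -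
    define m where "m = real n powr (1 / c)"
    have n: "m0 powr c \<le> real n" using n0 unfolding n0_def by linarith
    have "0 < m0 powr c" using m0 \<alpha> by simp
    with n have npos: "0 < real n" by linarith
    have "(m0 powr c) powr (1 / c) \<le> m"
      unfolding m_def using n c by (intro powr_mono2) auto
    then have mm0: "m0 \<le> m" using c m0 \<alpha> by (simp add: powr_powr)
    then have m: "1 \<le> m" "\<alpha> \<le> m" using m0 \<alpha> by auto
    have "m ^ C = m powr real C" using m by (simp add: powr_realpow)
    also have "\<dots> = real n" unfolding m_def C(1) using c npos by (simp add: powr_powr)
    finally have mC: "m ^ C = real n" .
    define p where "p = \<alpha> * real n powr (- 1 / real_of_int c)"
    have p_eq: "p = \<alpha> / m" unfolding p_def m_def by (simp add: powr_minus_divide)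
    have p: "0 < p" "p \<le> 1" using m \<alpha> by (auto simp: p_eq)
    define \<rho> where "\<rho> = \<kappa> / m"
    have \<rho>: "0 < \<rho>" "\<rho> \<le> 1" using \<kappa> m by (auto simp: \<rho>_def)
    have ratio: "2 * \<rho> / p \<le> 2 * \<kappa>"
    proof -
      have "2 * \<rho> / p = 2 * \<kappa> / \<alpha>" using m \<alpha> by (simp add: \<rho>_def p_eq)
      also have "\<dots> \<le> 2 * \<kappa> / 1" using \<kappa> \<alpha> by (intro divide_left_mono) auto
      finally show ?thesis by simp
    qed
    have heavy: "d / \<rho> ^ (C - 1) \<le> \<epsilon> / 2 * real n"
    proof -
      have "d / \<rho> ^ (C - 1) = d / \<kappa> ^ (C - 1) * m ^ (C - 1)"
        using m by (simp add: \<rho>_def power_divide)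
      also have "d / \<kappa> ^ (C - 1) \<le> \<epsilon> / 2 * m"
        using order_trans[OF m0(2) mm0] \<open>0 < \<epsilon>\<close> \<kappa>(1) by (simp add: field_simps)
      also have "\<epsilon> / 2 * m * m ^ (C - 1) = \<epsilon> / 2 * m ^ C"
        using C(2) by (cases C) auto
      finally show ?thesis using m by (simp add: mC mult_right_mono)
    qed
    \<comment> \<open>Rejecting only when the sample rules out every word of \<open>P\<close> makes
      one-sidedness immediate.\<close>
    define D where "D W u \<longleftrightarrow> \<not> (\<exists>z\<in>P. restrict z W = u)" for W and u :: "nat \<Rightarrow> 'a"
    have "one_sided_sampling_tester n S P \<epsilon> p D"
      unfolding one_sided_sampling_tester_def
    proof (intro conjI ballI impI)
      show "p \<in> {0..1}" using p by simp
      show "sampling_reject_prob n p D x = 0" if "x \<in> P" for x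
      proof -
        have "{W. D W (restrict x W)} = {}" using that by (auto simp: D_def)
        then show ?thesis by (simp add: sampling_reject_prob_def)
      qed
      show "2 / 3 \<le> sampling_reject_prob n p D x" if "x \<in> words n S" "far n \<epsilon> x P" for x
        unfolding D_def
      proof (rule prob_inconsistent_sample_ge[where T = T and c = C and \<rho> = \<rho> and \<beta> = \<beta>
            and \<delta> = \<delta> and S = S and \<epsilon> = \<epsilon>])
        show "2 * \<rho> / p * (avg_queries T * ln (card S) + ln 3) \<le> \<beta>"
          using mult_right_mono[OF ratio, of L] L \<kappa>(3) by (simp add: T(3) S(2) L_def)
        show "2 * \<rho> / p \<le> 1" using ratio \<kappa>(2) by linarith
      qed (use npos C S P T far \<beta> \<rho> heavy p that assms(7) in auto)
    qed
    moreover have "expected_samples n p = \<alpha> * real n powr (1 - 1 / real_of_int c)"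
    proof -
      have "expected_samples n p = real n * p" using p by (intro expected_samples_eq) auto
      also have "\<dots> = \<alpha> * real n powr (1 - 1 / real_of_int c)"
        using npos by (simp add: p_def powr_diff powr_minus_divide)
      finally show ?thesis .
    qed
    ultimately show ?thesis
      using p(2) unfolding Let_def p_def[symmetric] by blast
  qed
  show ?thesis
    by (intro conjI exI[of _ n0] allI impI \<beta>, rule main) auto
qed

end
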